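(* Let $X$ be a completely regular topological space endowed with an admissible family of open coverings $\mathcal{O}$, and let $\mathcal{H}(X)$ be the set of all nonempty closed subsets of $X$. For any $A\in\mathcal{H}(X)$ and $\mathcal{U},\mathcal{V}\in\mathcal{O}$, one has the inclusions: 1. $D_{\mathcal{V}}[A]\subset \mathrm{B}_{H}(A,\mathcal{U})\subset D_{\mathcal{U}}[A]$ whenever $\mathcal{V}\leqslant\frac12\mathcal{U}$. 2. $\mathrm{St}[A,\upsilon(D_{\mathcal{V}})]\subset \mathrm{B}_{H}(A,\mathcal{U})\subset \mathrm{St}[A,\upsilon(D_{\mathcal{U}})]$ whenever $\mathcal{V}\leqslant\frac{1}{2^{2}}\mathcal{U}$.
   Context: For coverings $\mathcal{U},\mathcal{V}$ of $X$, $\mathcal{V}\leqslant\frac12\mathcal{U}$ means: for all $V,V'\in\mathcal{V}$ with $V\cap V'\neq\emptyset$ there is $U\in\mathcal{U}$ with $V\cup V'\subset U$; and $\mathcal{V}\leqslant\frac1{2^2}\mathcal{U}$ means there is a covering $\mathcal{W}$ of $X$ with $\mathcal{V}\leqslant\frac12\mathcal{W}$ and $\mathcal{W}\leqslant\frac12\mathcal{U}$. For a covering $\mathcal{U}$ of a set $Z$ and $Y\subset Z$, the star is $\mathrm{St}[Y,\mathcal{U}]=\bigcup\{U\in\mathcal{U}: Y\cap U\neq\emptyset\}$, and for a point $z\in Z$, $\mathrm{St}[z,\mathcal{U}]=\mathrm{St}[\{z\},\mathcal{U}]$. A family $\mathcal{O}$ of open coverings of $X$ is admissible if (1) for any $\mathcal{U},\mathcal{V}\in\mathcal{O}$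 there is $\mathcal{W}\in\mathcal{O}$ with $\mathcal{W}\leqslant\frac12\mathcal{U}$ and $\mathcal{W}\leqslant\frac12\mathcal{V}$; and (2) the stars $\mathrm{St}[x,\mathcal{U}]$, $x\in X$, $\mathcal{U}\in\mathcal{O}$, form a basis for the topology of $X$. For $A\in\mathcal{H}(X)$ and $\mathcal{U}\in\mathcal{O}$: $\mathrm{B}_{H}(A,\mathcal{U})=\{B\in\mathcal{H}(X): A\subset\mathrm{St}[B,\mathcal{U}]\text{ and }B\subset\mathrm{St}[A,\mathcal{U}]\}$; $D_{\mathcal{U}}=\bigcup\{\mathrm{B}_{H}(C,\mathcal{U})\times\mathrm{B}_{H}(C,\mathcal{U}): C\in\mathcal{H}(X)\}$. For $D\subset\mathcal{H}(X)\times\mathcal{H}(X)$: $D[A]=\{B\in\mathcal{H}(X):(A,B)\in D\}$ and $\upsilon(D)=\{D[C]:C\in\mathcal{H}(X)\}$, which for $D=D_{\mathcal{U}}$ is a covering of $\mathcal{H}(X)$; $\mathrm{St}[A,\upsilon(D)]$ is the star of the point $A\in\mathcal{H}(X)$ with respect to this covering of $\mathcal{H}(X)$. *)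

theory Defs
  imports "HOL-Analysis.Analysis"
begin

definition covering_of :: "'a set \<Rightarrow> 'a set set \<Rightarrow> bool" where
  "covering_of Z \<C> \<longleftrightarrow> (\<forall>C\<in>\<C>. C \<subseteq> Z) \<and> \<Union>\<C> = Z"

definition half_refines :: "'a set set \<Rightarrow> 'a set set \<Rightarrow> bool" where
  "half_refines \<V> \<U> \<longleftrightarrow>
     (\<forall>V\<in>\<V>. \<forall>V'\<in>\<V>. V \<inter> V' \<noteq> {} \<longrightarrow> (\<exists>U\<in>\<U>. V \<union> V' \<subseteq> U))"

text \<open>The intermediate covering is not required to be open.\<close>

definition quarter_refines :: "'a set \<Rightarrow> 'a set set \<Rightarrow> 'a set set \<Rightarrow> bool" where
  "quarter_refines Z \<V> \<U> \<longleftrightarrow>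
     (\<exists>\<W>. covering_of Z \<W> \<and> half_refines \<V> \<W> \<and> half_refines \<W> \<U>)"

text \<open>The type of points is polymorphic, as stars are taken both of subsets of the space and,
  one level up, of points of the hyperspace; the star of a point \<open>z\<close> is \<open>Star {z} \<U>\<close>.\<close>

definition Star :: "'a set \<Rightarrow> 'a set set \<Rightarrow> 'a set" where
  "Star Y \<U> = \<Union>{U \<in> \<U>. Y \<inter> U \<noteq> {}}"

text \<open>The last conjunct says that the stars of points form a basis of the topology: they are
  open, and every open set is a union of them.\<close>

definition admissible_family :: "'a topology \<Rightarrow> 'a set set set \<Rightarrow> bool" where
  "admissible_family X \<O> \<longleftrightarrow>
     (\<forall>\<U>\<in>\<O>. covering_of (topspace X) \<U> \<and> (\<forall>U\<in>\<U>. openin X U)) \<and>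
     (\<forall>\<U>\<in>\<O>. \<forall>\<V>\<in>\<O>. \<exists>\<W>\<in>\<O>. half_refines \<W> \<U> \<and> half_refines \<W> \<V>) \<and>
     openin X = arbitrary union_of
       (\<lambda>S. S \<in> {Star {x} \<U> | x \<U>. x \<in> topspace X \<and> \<U> \<in> \<O>})"

definition hyperspace :: "'a topology \<Rightarrow> 'a set set" where
  "hyperspace X = {A. closedin X A \<and> A \<noteq> {}}"

definition BH :: "'a topology \<Rightarrow> 'a set \<Rightarrow> 'a set set \<Rightarrow> 'a set set" where
  "BH X A \<U> = {B \<in> hyperspace X. A \<subseteq> Star B \<U> \<and> B \<subseteq> Star A \<U>}"

definition Dset :: "'a topology \<Rightarrow> 'a set set \<Rightarrow> ('a set \<times> 'a set) set" where
  "Dset X \<U> = (\<Union>C\<in>hyperspace X. BH X C \<U> \<times> BH X C \<U>)"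

definition section_at ::
  "'a topology \<Rightarrow> ('a set \<times> 'a set) set \<Rightarrow> 'a set \<Rightarrow> 'a set set" where
  "section_at X D A = {B \<in> hyperspace X. (A, B) \<in> D}"

definition upsilon :: "'a topology \<Rightarrow> ('a set \<times> 'a set) set \<Rightarrow> 'a set set set" where
  "upsilon X D = {section_at X D C | C. C \<in> hyperspace X}"

end

theory Submission
  imports Defs
begin

text \<open>Write \<open>A \<sim>\<^sub>\<U> B\<close> for \<open>B \<in> BH X A \<U>\<close>, a relation on nonempty closed sets that is symmetric and,
  when \<open>\<U>\<close> covers the space, reflexive. By definition \<open>Dset X \<U>\<close> is then its composite with
  itself: \<open>(A, B) \<in> Dset X \<U>\<close> iff \<open>A \<sim>\<^sub>\<U> C \<sim>\<^sub>\<U> B\<close> for some closed nonempty \<open>C\<close>.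
  Reflexivity gives the two inclusions that enlarge \<open>BH X A \<U>\<close>, taking \<open>C = A\<close>.

  The other two inclusions rest on a triangle inequality (\<open>Star_trans_half_refines\<close>): passing
  from \<open>\<U>\<close> to a half refinement absorbs one composition. Membership in the section \<open>D\<^sub>\<V>[A]\<close>
  needs one such step. A common member of \<open>\<upsilon>(D\<^sub>\<V>)\<close> for \<open>A\<close> and \<open>B\<close> is a chain of four
  \<open>\<V>\<close>-steps from \<open>A\<close> to \<open>B\<close>; a quarter refinement halves its length twice, first to two
  \<open>\<W>\<close>-steps and then to a single \<open>\<U>\<close>-step.\<close>

text \<open>A point \<open>a\<close> of \<open>A\<close> shares a member of \<open>\<V>\<close> with some \<open>c\<close> in \<open>C\<close>, and \<open>c\<close> shares a
  member of \<open>\<V>\<close> with a point of \<open>B\<close>; the two members meet in \<open>c\<close>, so one member of \<open>\<U>\<close>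
  contains both.\<close>

lemma Star_trans_half_refines:
  assumes "half_refines \<V> \<U>" and "A \<subseteq> Star C \<V>" and "C \<subseteq> Star B \<V>"
  shows "A \<subseteq> Star B \<U>"
proof
  fix a assume "a \<in> A"
  with assms(2) obtain V c where V: "V \<in> \<V>" "a \<in> V" "c \<in> C" "c \<in> V"
    unfolding Star_def by blast
  with assms(3) obtain V' b where V': "V' \<in> \<V>" "c \<in> V'" "b \<in> B" "b \<in> V'"
    unfolding Star_def by blast
  from V V' have "V \<inter> V' \<noteq> {}" by blast
  with assms(1) V V' obtain U where "U \<in> \<U>" "V \<union> V' \<subseteq> U"
    unfolding half_refines_def by blast
  with V V' show "a \<in> Star B \<U>"
    unfolding Star_def by blast
qed

lemma subset_Star:
  assumes "covering_of Z \<U>" and "A \<subseteq> Z"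
  shows "A \<subseteq> Star A \<U>"
  using assms unfolding covering_of_def Star_def by blast

lemma BH_refl:
  assumes "covering_of (topspace X) \<U>" and "A \<in> hyperspace X"
  shows "A \<in> BH X A \<U>"
proof -
  have "A \<subseteq> topspace X"
    using assms(2) closedin_subset unfolding hyperspace_def by blast
  with assms show ?thesis
    using subset_Star unfolding BH_def by blast
qed

lemma section_Dset_subset_BH:
  assumes "half_refines \<V> \<U>"
  shows "section_at X (Dset X \<V>) A \<subseteq> BH X A \<U>"
proof
  fix B assume "B \<in> section_at X (Dset X \<V>) A"
  then obtain C where B: "B \<in> hyperspace X"
    and "A \<subseteq> Star C \<V>" "C \<subseteq> Star A \<V>" "B \<subseteq> Star C \<V>" "C \<subseteq> Star B \<V>"
    unfolding section_at_def Dset_def BH_def by blast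
  then have "A \<subseteq> Star B \<U>" "B \<subseteq> Star A \<U>"
    using Star_trans_half_refines[OF assms] by blast+
  with B show "B \<in> BH X A \<U>"
    unfolding BH_def by blast
qed

lemma BH_subset_section_Dset:
  assumes "covering_of (topspace X) \<U>" and "A \<in> hyperspace X"
  shows "BH X A \<U> \<subseteq> section_at X (Dset X \<U>) A"
  using BH_refl[OF assms] assms(2) unfolding section_at_def Dset_def BH_def by blast

text \<open>If \<open>A\<close> and \<open>B\<close> both lie in the section \<open>D\<^sub>\<V>[C]\<close>, then both are \<open>\<W>\<close>-close to \<open>C\<close>, so
  \<open>C\<close> itself witnesses \<open>(A, B) \<in> Dset X \<W>\<close>, and a second halving applies.\<close>

lemma Star_upsilon_subset_BH:
  assumes "quarter_refines Z \<V> \<U>"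
  shows "Star {A} (upsilon X (Dset X \<V>)) \<subseteq> BH X A \<U>"
proof
  fix B assume "B \<in> Star {A} (upsilon X (Dset X \<V>))"
  then obtain C where C: "C \<in> hyperspace X"
    "A \<in> section_at X (Dset X \<V>) C" "B \<in> section_at X (Dset X \<V>) C"
    unfolding Star_def upsilon_def by blast
  obtain \<W> where "half_refines \<V> \<W>" and \<W>\<U>: "half_refines \<W> \<U>"
    using assms unfolding quarter_refines_def by blast
  with C have "A \<in> BH X C \<W>" "B \<in> BH X C \<W>"
    using section_Dset_subset_BH by blast+
  with C(1) have "B \<in> section_at X (Dset X \<W>) A"
    unfolding section_at_def Dset_def BH_def by blast
  then show "B \<in> BH X A \<U>"
    using section_Dset_subset_BH[OF \<W>\<U>] by blast
qed

lemma BH_subset_Star_upsilon: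
  assumes "covering_of (topspace X) \<U>" and "A \<in> hyperspace X"
  shows "BH X A \<U> \<subseteq> Star {A} (upsilon X (Dset X \<U>))"
proof -
  \<comment> \<open>The section at \<open>A\<close> is itself a member of the covering that contains \<open>A\<close>.\<close>
  have "A \<in> section_at X (Dset X \<U>) A"
    using BH_refl[OF assms] BH_subset_section_Dset[OF assms] by blast
  then have "section_at X (Dset X \<U>) A \<subseteq> Star {A} (upsilon X (Dset X \<U>))"
    using assms(2) unfolding Star_def upsilon_def by blast
  then show ?thesis
    using BH_subset_section_Dset[OF assms] by blast
qed

theorem theorem3:
  fixes X :: "'a topology" and \<O> :: "'a set set set"
    and A :: "'a set" and \<U> \<V> :: "'a set set"
  assumes "completely_regular_space X"
    and "admissible_family X \<O>"
    and "A \<in> hyperspace X"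
    and "\<U> \<in> \<O>" and "\<V> \<in> \<O>"
  shows "(half_refines \<V> \<U> \<longrightarrow>
            section_at X (Dset X \<V>) A \<subseteq> BH X A \<U> \<and>
            BH X A \<U> \<subseteq> section_at X (Dset X \<U>) A) \<and>
         (quarter_refines (topspace X) \<V> \<U> \<longrightarrow>
            Star {A} (upsilon X (Dset X \<V>)) \<subseteq> BH X A \<U> \<and>
            BH X A \<U> \<subseteq> Star {A} (upsilon X (Dset X \<U>)))"
proof -
  have "covering_of (topspace X) \<U>"
    using assms(2,4) unfolding admissible_family_def by blast
  then show ?thesis
    using section_Dset_subset_BH BH_subset_section_Dset
      Star_upsilon_subset_BH BH_subset_Star_upsilon assms(3) by metis
qed

end
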